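(* Let $\mathcal{M}=(E,\mathcal{C})$ be a graphic oriented matroid of rank $r$, let $e\in E$, and let $B,B'$ be $e$-embracing bases of $\mathcal{M}$. Then $d_e(B,B')\leq r$.
   Context: A graphic oriented matroid is the oriented matroid on the arc set $E$ of a finite directed graph $D$ whose signed circuits come from the cycles of the underlying undirected graph: a choice of traversal of a cycle determines a signed circuit by assigning sign $+$ to the arcs whose orientation agrees with the traversal and sign $-$ to the other arcs of the cycle. $\mathcal{C}$ is the set of signed circuits; $\underline{X}$ denotes the support of a signed set $X$. A circuit $X\in\mathcal{C}$ is positive if $X(f)\in\{0,+\}$ for all $f\in E$; $\mathcal{C}_e^+$ is the set of positive circuits $X$ with $X(e)=+$. For a basis $B$ (of the underlying matroid) with $e\notin B$, the fundamental circuit $C(B,e)$ is the unique $X\in\mathcal{C}$ with $\underline{X}\subseteq B\cup\{e\}$ and $X(e)=+$. The basis $B$ (with $e\notin B$) is $e$-embracing if $C(B,e)\in\mathcal{C}_e^+$. The $e$-embracing distance $d_e(B,B')$ of two $e$-embracing bases is the minimum $k$ such that there is a sequence $B=B_0,B_1,\ldots,B_k=B'$ of $e$-embracing bases with $|B_{i-1}\Delta B_i|=2$ for all $i\in\{1,\dots,k\}$ ($\infty$ if there is none). *)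

theory Defs
  imports "Graph_Theory.Arc_Walk" "HOL-Library.Extended_Nat"
begin

section \<open>Signed sets and circuit systems\<close>

text \<open>
  A signed subset of \<open>E\<close> is a function into \<open>{-1, 0, 1}\<close>, with \<open>1\<close>, \<open>-1\<close>, \<open>0\<close> standing for the
  signs \<open>+\<close>, \<open>-\<close> and \<open>0\<close>; it vanishes outside \<open>E\<close>. An oriented matroid is given by its ground set
  \<open>E\<close> and its set \<open>C\<close> of signed circuits.
\<close>

type_synonym 'a signed_set = "'a \<Rightarrow> int"

definition support :: "'a signed_set \<Rightarrow> 'a set" where
  "support X = {f. X f \<noteq> 0}"

definition om_indep :: "'a set \<Rightarrow> 'a signed_set set \<Rightarrow> 'a set \<Rightarrow> bool" where
  "om_indep E C I \<longleftrightarrow> I \<subseteq> E \<and> (\<forall>X\<in>C. \<not> support X \<subseteq> I)"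

definition om_basis :: "'a set \<Rightarrow> 'a signed_set set \<Rightarrow> 'a set \<Rightarrow> bool" where
  "om_basis E C B \<longleftrightarrow> om_indep E C B \<and> (\<forall>I. om_indep E C I \<longrightarrow> B \<subseteq> I \<longrightarrow> I = B)"

definition om_rank :: "'a set \<Rightarrow> 'a signed_set set \<Rightarrow> nat" where
  "om_rank E C = Max (card ` {I. om_indep E C I})"

definition positive_circuits_at :: "'a set \<Rightarrow> 'a signed_set set \<Rightarrow> 'a \<Rightarrow> 'a signed_set set" where
  "positive_circuits_at E C e = {X \<in> C. (\<forall>f\<in>E. X f \<in> {0, 1}) \<and> X e = 1}"

definition fund_circuit :: "'a signed_set set \<Rightarrow> 'a set \<Rightarrow> 'a \<Rightarrow> 'a signed_set" where
  "fund_circuit C B e = (THE X. X \<in> C \<and> support X \<subseteq> B \<union> {e} \<and> X e = 1)"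

definition embracing_basis :: "'a set \<Rightarrow> 'a signed_set set \<Rightarrow> 'a \<Rightarrow> 'a set \<Rightarrow> bool" where
  "embracing_basis E C e B \<longleftrightarrow>
     om_basis E C B \<and> e \<notin> B \<and> fund_circuit C B e \<in> positive_circuits_at E C e"

definition embracing_path ::
  "'a set \<Rightarrow> 'a signed_set set \<Rightarrow> 'a \<Rightarrow> 'a set \<Rightarrow> 'a set \<Rightarrow> nat \<Rightarrow> (nat \<Rightarrow> 'a set) \<Rightarrow> bool" where
  "embracing_path E C e B B' k S \<longleftrightarrow>
     S 0 = B \<and> S k = B' \<and> (\<forall>i\<in>{0..k}. embracing_basis E C e (S i)) \<and>
     (\<forall>i\<in>{1..k}. card ((S (i - 1) - S i) \<union> (S i - S (i - 1))) = 2)"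

text \<open>The infimum in \<^typ>\<open>enat\<close> is a minimum, and it is \<open>\<infinity>\<close> when there is no path.\<close>

definition embracing_distance ::
  "'a set \<Rightarrow> 'a signed_set set \<Rightarrow> 'a \<Rightarrow> 'a set \<Rightarrow> 'a set \<Rightarrow> enat" where
  "embracing_distance E C e B B' = Inf {enat k |k. \<exists>S. embracing_path E C e B B' k S}"

section \<open>Graphic oriented matroids\<close>

text \<open>
  To walk along arcs in either direction, every arc \<open>a\<close> is replaced by \<open>(a, True)\<close>, which runs from
  the tail of \<open>a\<close> to its head, and \<open>(a, False)\<close>, which runs backwards.
\<close>

definition two_way :: "('v, 'a) pre_digraph \<Rightarrow> ('v, 'a \<times> bool) pre_digraph" where
  "two_way D = \<lparr>verts = verts D, arcs = arcs D \<times> UNIV,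
     tail = (\<lambda>(a, fwd). if fwd then tail D a else head D a),
     head = (\<lambda>(a, fwd). if fwd then head D a else tail D a)\<rparr>"

text \<open>
  A traversed cycle of the underlying undirected multigraph. Loops (length 1, with two traversals)
  and pairs of parallel or antiparallel arcs (length 2) are cycles; distinctness of the arcs only
  excludes going back and forth along a single arc.
\<close>

definition cycle_traversal :: "('v, 'a) pre_digraph \<Rightarrow> ('a \<times> bool) list \<Rightarrow> bool" where
  "cycle_traversal D p \<longleftrightarrow> pre_digraph.cycle (two_way D) p \<and> distinct (map fst p)"

definition traversal_signs :: "('a \<times> bool) list \<Rightarrow> 'a signed_set" where
  "traversal_signs p f =
     (if (f, True) \<in> set p then 1 else if (f, False) \<in> set p then -1 else 0)"

definition graphic_circuits :: "('v, 'a) pre_digraph \<Rightarrow> 'a signed_set set" where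
  "graphic_circuits D = {traversal_signs p |p. cycle_traversal D p}"

text \<open>
  \<^locale>\<open>fin_digraph\<close> permits loops and multiple arcs and does not ask for connectedness.
\<close>

definition graphic_oriented_matroid ::
  "('v, 'a) pre_digraph \<Rightarrow> 'a set \<Rightarrow> 'a signed_set set \<Rightarrow> bool" where
  "graphic_oriented_matroid D E C \<longleftrightarrow> fin_digraph D \<and> E = arcs D \<and> C = graphic_circuits D"

end

theory Submission
  imports Defs
begin

text \<open>
  Let \<open>s\<close> be the head and \<open>t\<close> the tail of \<open>e\<close>. A basis is a spanning forest, and it is
  \<open>e\<close>-embracing iff it avoids \<open>e\<close> and its path from \<open>s\<close> to \<open>t\<close> is directed, since that path
  followed by \<open>e\<close> is the fundamental circuit.

  Choose a root in every component, with \<open>t\<close> the root of its own. A spanning forest then assigns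
  to every vertex outside the set \<open>R\<close> of roots a parent arc, the first arc of its path to the
  root, and it is determined by this assignment. Let \<open>p\<close> and \<open>p'\<close> be the assignments of \<open>B\<close>
  and \<open>B'\<close>. The path from \<open>B\<close> to \<open>B'\<close> replaces \<open>p v\<close> by \<open>p' v\<close> for one vertex \<open>v\<close> at a
  time. Every vertex is treated once, so there are at most \<open>|V - R| = r\<close> steps; what has to be
  chosen well is the order of the vertices.

  To get a forest at every moment, a vertex is switched only after its \<open>p'\<close>-parent has been
  switched or if that parent is a root: then the switched vertices hang below the roots exactly as
  in \<open>B'\<close>, and no cycle can arise (\<open>switched_forest\<close>). To get an embracing forest at every moment,
  the vertices on the directed path of \<open>B'\<close> from \<open>s\<close> to \<open>t\<close> come first, from \<open>t\<close> backwards.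
  As long as \<open>s\<close> has not been switched, the current path from \<open>s\<close> follows the directed path of \<open>B\<close>
  until it ends or meets a switched vertex, and from there it follows the directed path of \<open>B'\<close>.
  Once \<open>s\<close> has been switched, the current path is that of \<open>B'\<close> and stays so
  (\<open>switched_forward_path\<close>). The invariant used below, \<open>forward_first\<close>, is more generous: up to
  the switch of \<open>s\<close> it admits every vertex from which \<open>p'\<close> climbs to \<open>t\<close> along forward arcs.

  The translation between bases and parent assignments rests on two facts. Bases span, because
  maximality puts a circuit through every arc outside a basis. And a fundamental circuit is unique,
  because signed circuits lie in the kernel of the incidence matrix, while the incidence vectors of
  the parent arcs are linearly independent (\<open>forest_no_cycle_vector\<close>).
\<close>

context fin_digraph
begin

section \<open>Walking along arcs in both directions\<close>

abbreviation src :: "'b \<times> bool \<Rightarrow> 'a" where "src \<equiv> tail (two_way G)"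
abbreviation dst :: "'b \<times> bool \<Rightarrow> 'a" where "dst \<equiv> head (two_way G)"

lemma src_dst_simps [simp]:
  "src (f, True) = tail G f" "src (f, False) = head G f"
  "dst (f, True) = head G f" "dst (f, False) = tail G f"
  by (simp_all add: two_way_def)

lemma two_way_sets [simp]:
  "verts (two_way G) = verts G" "arcs (two_way G) = arcs G \<times> UNIV"
  by (simp_all add: two_way_def)

lemma src_dst_in_verts:
  assumes "fst a \<in> arcs G"
  shows "src a \<in> verts G" "dst a \<in> verts G"
  using assms by (cases a; cases "snd a"; simp)+

text \<open>
  Walks, paths and cycles of the underlying undirected multigraph are those of the doubled digraph;
  they carry the prefix \<open>W\<close>.
\<close>

interpretation W: wf_digraph "two_way G"
  by unfold_locales (auto intro: src_dst_in_verts)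

text \<open>
  Reachability by steps is used instead of walks wherever the list of arcs is irrelevant; the two
  are linked by \<open>walk_imp_steps\<close> and \<open>steps_imp_path\<close>.
\<close>

definition steps :: "('b \<times> bool) set \<Rightarrow> 'a rel" where
  "steps T = (\<lambda>a. (src a, dst a)) ` T"

lemma stepsI: "a \<in> T \<Longrightarrow> (src a, dst a) \<in> steps T"
  by (auto simp: steps_def)

lemma stepsE:
  assumes "(u, v) \<in> steps T"
  obtains a where "a \<in> T" "src a = u" "dst a = v"
  using assms by (auto simp: steps_def)

lemma steps_mono: "T \<subseteq> T' \<Longrightarrow> steps T \<subseteq> steps T'"
  by (auto simp: steps_def)

lemma steps_rtrancl_mono: "T \<subseteq> T' \<Longrightarrow> (u, v) \<in> (steps T)\<^sup>* \<Longrightarrow> (u, v) \<in> (steps T')\<^sup>*"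
  using rtrancl_mono[OF steps_mono] by blast

lemma sym_steps: "sym ((steps (A \<times> UNIV))\<^sup>*)"
proof (rule sym_rtrancl, rule symI)
  fix u v assume "(u, v) \<in> steps (A \<times> UNIV)"
  then obtain f b where "f \<in> A" "src (f, b) = u" "dst (f, b) = v"
    by (auto elim: stepsE)
  then show "(v, u) \<in> steps (A \<times> UNIV)"
    using stepsI[of "(f, \<not> b)" "A \<times> UNIV"] by (cases b) auto
qed

lemma walk_imp_steps: "W.awalk u P v \<Longrightarrow> (u, v) \<in> (steps (set P))\<^sup>*"
proof (induction P arbitrary: u)
  case Nil
  then show ?case by (simp add: W.awalk_Nil_iff)
next
  case (Cons a P)
  then have "(dst a, v) \<in> (steps (set (a # P)))\<^sup>*"
    using steps_rtrancl_mono[of "set P" "set (a # P)"] by (auto simp: W.awalk_Cons_iff)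
  moreover have "(u, dst a) \<in> steps (set (a # P))"
    using Cons.prems stepsI[of a "set (a # P)"] by (auto simp: W.awalk_Cons_iff)
  ultimately show ?case by (rule converse_rtrancl_into_rtrancl[rotated])
qed

lemma steps_imp_path:
  assumes "(u, v) \<in> (steps T)\<^sup>*" "T \<subseteq> arcs G \<times> UNIV" "v \<in> verts G"
  obtains P where "W.apath u P v" "set P \<subseteq> T"
proof -
  from assms(1) have "\<exists>P. W.awalk u P v \<and> set P \<subseteq> T"
  proof (induction rule: converse_rtrancl_induct)
    case base
    then show ?case using assms(3) by (auto simp: W.awalk_Nil_iff intro!: exI[of _ "[]"])
  next
    case (step y z)
    then obtain P a where "W.awalk z P v" "set P \<subseteq> T" "a \<in> T" "src a = y" "dst a = z"
      by (auto elim: stepsE)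
    then show ?case using assms(2)
      by (intro exI[of _ "a # P"]) (auto simp: W.awalk_Cons_iff)
  qed
  then obtain P where "W.awalk u P v" "set P \<subseteq> T" by blast
  then show thesis
    using that[OF W.apath_awalk_to_apath] W.awalk_to_apath_subset by blast
qed

text \<open>
  Using an arc a second time, in whichever direction, revisits the vertex from which it was first
  left.
\<close>

lemma apath_distinct_arcs: "W.apath u P v \<Longrightarrow> distinct (map fst P)"
proof (induction P arbitrary: u)
  case (Cons a P)
  obtain f b where a: "a = (f, b)" by (cases a)
  have P: "W.apath (dst a) P v" "src a \<notin> set (W.awalk_verts (dst a) P)"
    using Cons.prems by (auto simp: W.apath_Cons_iff)
  then have on: "set (W.awalk_verts (dst a) P) = {dst a} \<union> set (map src P) \<union> set (map dst P)"
    by (intro W.set_awalk_verts) (auto simp: W.apath_def)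
  have "(f, b') \<notin> set P" for b'
  proof
    assume "(f, b') \<in> set P"
    then have "src (f, b') \<in> set (W.awalk_verts (dst a) P)"
      "dst (f, b') \<in> set (W.awalk_verts (dst a) P)"
      unfolding on by force+
    then show False using P(2) a by (cases b; cases b') auto
  qed
  then show ?case using Cons.IH[OF P(1)] a by auto
qed simp

text \<open>
  The source of all circuits below: an arc together with a connection of its ends that avoids it.
  The walk is part of the conclusion because the signs of the circuit are later read off its arcs.
\<close>

lemma path_closes_cycle:
  assumes "f \<in> arcs G" "(head G f, tail G f) \<in> (steps T)\<^sup>*" "T \<subseteq> (arcs G - {f}) \<times> UNIV"
  obtains P where "set P \<subseteq> T" "W.awalk (head G f) P (tail G f)"
    "cycle_traversal G ((f, True) # P)"
proof -
  obtain P where P: "W.apath (head G f) P (tail G f)" "set P \<subseteq> T"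
    using steps_imp_path[OF assms(2)] assms(1,3) by auto
  have "W.cycle ((f, True) # P)"
    using P(1) assms(1) by (auto simp: W.cycle_def W.apath_def W.awalk_Cons_iff)
  moreover have "distinct (map fst ((f, True) # P))"
    using apath_distinct_arcs[OF P(1)] P(2) assms(3) by auto
  ultimately show thesis
    using that P by (auto simp: cycle_traversal_def W.apath_def)
qed

section \<open>Circuits have no boundary\<close>

lemma sum_differences_walk:
  fixes \<phi> :: "'a \<Rightarrow> int"
  shows "W.awalk u P v \<Longrightarrow> (\<Sum>a\<leftarrow>P. \<phi> (dst a) - \<phi> (src a)) = \<phi> v - \<phi> u"
  by (induction P arbitrary: u) (auto simp: W.awalk_Nil_iff W.awalk_Cons_iff)

lemma traversal_signs_arc:
  assumes "distinct (map fst P)" "(f, b) \<in> set P"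
  shows "traversal_signs P f = (if b then 1 else -1)"
  using assms(2) eq_key_imp_eq_value[OF assms, of "\<not> b"]
  by (cases b) (auto simp add: traversal_signs_def)

lemma support_traversal_signs: "support (traversal_signs P) = fst ` set P"
proof (rule set_eqI)
  fix f
  have "f \<in> fst ` set P \<longleftrightarrow> (\<exists>b. (f, b) \<in> set P)" by force
  also have "\<dots> \<longleftrightarrow> (f, True) \<in> set P \<or> (f, False) \<in> set P" by (rule ex_bool_eq)
  finally show "f \<in> support (traversal_signs P) \<longleftrightarrow> f \<in> fst ` set P"
    by (simp add: support_def traversal_signs_def)
qed

lemma cycle_arcs: "cycle_traversal G P \<Longrightarrow> fst ` set P \<subseteq> arcs G"
  by (auto simp: cycle_traversal_def W.cycle_def W.awalk_def)

text \<open>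
  A circuit lies in the kernel of the incidence matrix. Testing against all potentials \<open>\<phi>\<close>
  instead of single vertices turns the claim into a telescoping sum along the closed walk.
\<close>

lemma circuit_boundary:
  fixes \<phi> :: "'a \<Rightarrow> int"
  assumes "X \<in> graphic_circuits G"
  shows "(\<Sum>f\<in>arcs G. X f * (\<phi> (head G f) - \<phi> (tail G f))) = 0"
proof -
  obtain P where X: "X = traversal_signs P" and P: "cycle_traversal G P"
    using assms by (auto simp: graphic_circuits_def)
  then obtain u where u: "W.awalk u P u" and dist: "distinct (map fst P)"
    by (auto simp: cycle_traversal_def W.cycle_def)
  let ?g = "\<lambda>f. X f * (\<phi> (head G f) - \<phi> (tail G f))"
  have "sum ?g (arcs G) = sum ?g (fst ` set P)"
    using cycle_arcs[OF P] support_traversal_signs[of P] X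
    by (intro sum.mono_neutral_right) (auto simp: support_def)
  also have "\<dots> = (\<Sum>f\<leftarrow>map fst P. ?g f)"
    using sum_list_distinct_conv_sum_set[OF dist, of ?g] by simp
  also have "\<dots> = (\<Sum>a\<leftarrow>P. \<phi> (dst a) - \<phi> (src a))"
  proof -
    have "?g (fst a) = \<phi> (dst a) - \<phi> (src a)" if "a \<in> set P" for a
      using traversal_signs_arc[OF dist, of "fst a" "snd a"] that X
      by (cases a; cases "snd a") auto
    then show ?thesis by (simp cong: map_cong)
  qed
  also have "\<dots> = 0"
    using sum_differences_walk[OF u] by simp
  finally show ?thesis .
qed

lemma circuit_support_nonempty:
  assumes "X \<in> graphic_circuits G"
  shows "support X \<noteq> {}"
proof -
  obtain P where X: "X = traversal_signs P" and P: "cycle_traversal G P"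
    using assms by (auto simp: graphic_circuits_def)
  have "P \<noteq> []"
    using P by (auto simp: cycle_traversal_def W.cycle_def)
  then show ?thesis
    by (simp add: X support_traversal_signs)
qed

text \<open>
  What remains of a closed walk after deleting one arc still joins the ends of that arc.
\<close>

lemma circuit_connects_ends:
  assumes "X \<in> graphic_circuits G" "f \<in> support X"
  shows "(tail G f, head G f) \<in> (steps ((support X - {f}) \<times> UNIV))\<^sup>*"
proof -
  obtain P where X: "X = traversal_signs P" and P: "cycle_traversal G P"
    using assms(1) by (auto simp: graphic_circuits_def)
  then obtain u where u: "W.awalk u P u" and dist: "distinct (map fst P)"
    by (auto simp: cycle_traversal_def W.cycle_def)
  obtain b where "(f, b) \<in> set P"
    using assms(2) by (auto simp: X support_traversal_signs)
  then obtain Q Q' where PQ: "P = Q @ (f, b) # Q'"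
    by (auto dest: split_list)
  have "W.awalk u Q (src (f, b))" "W.awalk (dst (f, b)) Q' u"
    using u unfolding PQ by (auto simp: W.awalk_append_iff W.awalk_Cons_iff)
  then have "W.awalk (dst (f, b)) (Q' @ Q) (src (f, b))"
    by (rule W.awalk_appendI[rotated])
  moreover have "set (Q' @ Q) \<subseteq> (support X - {f}) \<times> UNIV"
  proof
    fix a assume "a \<in> set (Q' @ Q)"
    then have "fst a \<in> fst ` set P" "fst a \<noteq> f"
      using dist by (auto simp: PQ)
    then show "a \<in> (support X - {f}) \<times> UNIV"
      by (simp add: X support_traversal_signs mem_Times_iff)
  qed
  ultimately have "(dst (f, b), src (f, b)) \<in> (steps ((support X - {f}) \<times> UNIV))\<^sup>*"
    using walk_imp_steps steps_rtrancl_mono by blast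
  then show ?thesis
    using symD[OF sym_steps] by (cases b) auto
qed

section \<open>Forests given by parent arcs\<close>

text \<open>
  \<open>p v\<close> is the arc from \<open>v\<close> to its parent, together with the direction in which it is climbed.
  The height function \<open>d\<close> excludes cyclic parenthood. On \<open>R\<close> the value of \<open>p\<close> is arbitrary.
\<close>

definition rooted_forest :: "'a set \<Rightarrow> ('a \<Rightarrow> 'b \<times> bool) \<Rightarrow> bool" where
  "rooted_forest R p \<longleftrightarrow>
     (\<forall>v\<in>verts G - R. fst (p v) \<in> arcs G \<and> src (p v) = v) \<and>
     (\<exists>d :: 'a \<Rightarrow> nat. \<forall>v\<in>verts G - R. d (dst (p v)) < d v)"

definition forest_arcs :: "'a set \<Rightarrow> ('a \<Rightarrow> 'b \<times> bool) \<Rightarrow> 'b set" where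
  "forest_arcs R p = (\<lambda>v. fst (p v)) ` (verts G - R)"

lemma forest_arcs_subset: "rooted_forest R p \<Longrightarrow> forest_arcs R p \<subseteq> arcs G"
  by (auto simp: rooted_forest_def forest_arcs_def)

lemma same_arc_ends: "fst a = fst b \<Longrightarrow> b = a \<or> (src b = dst a \<and> dst b = src a)"
  by (cases a; cases b; cases "snd a"; cases "snd b") auto

text \<open>
  Two vertices sharing a parent arc would be parents of each other.
\<close>

lemma forest_parent_inj:
  assumes "rooted_forest R p"
  shows "inj_on (\<lambda>v. fst (p v)) (verts G - R)"
proof (rule inj_onI)
  fix u v assume uv: "u \<in> verts G - R" "v \<in> verts G - R" "fst (p u) = fst (p v)"
  obtain d :: "'a \<Rightarrow> nat" where d: "\<forall>v\<in>verts G - R. d (dst (p v)) < d v"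
    using assms by (auto simp: rooted_forest_def)
  have src: "src (p u) = u" "src (p v) = v"
    using assms uv by (auto simp: rooted_forest_def)
  have "d (dst (p u)) < d u" "d (dst (p v)) < d v"
    using d uv by blast+
  then show "u = v"
    using same_arc_ends[OF uv(3)] src by auto
qed

text \<open>
  Linear independence of the parent arcs: at a highest vertex whose parent arc has a nonzero
  coefficient, no other arc in the support of \<open>Z\<close> is incident, because such an arc would be the
  parent arc of a child, which is higher. Hence the boundary of \<open>Z\<close> does not vanish there.
\<close>

lemma forest_no_cycle_vector:
  fixes Z :: "'b \<Rightarrow> int"
  assumes "rooted_forest R p" "support Z \<subseteq> forest_arcs R p"
    and boundary: "\<And>\<phi> :: 'a \<Rightarrow> int. (\<Sum>f\<in>arcs G. Z f * (\<phi> (head G f) - \<phi> (tail G f))) = 0"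
  shows "support Z = {}"
proof (rule ccontr)
  obtain d :: "'a \<Rightarrow> nat" where d: "\<And>v. v \<in> verts G - R \<Longrightarrow> d (dst (p v)) < d v"
    using assms(1) by (auto simp: rooted_forest_def)
  have p: "fst (p v) \<in> arcs G" "src (p v) = v" if "v \<in> verts G - R" for v
    using assms(1) that by (auto simp: rooted_forest_def)
  let ?S = "{v \<in> verts G - R. Z (fst (p v)) \<noteq> 0}"
  assume "support Z \<noteq> {}"
  then have "?S \<noteq> {}" using assms(2) by (auto simp: support_def forest_arcs_def)
  then have "Max (d ` ?S) \<in> d ` ?S" by (intro Max_in) auto
  then obtain v where v: "v \<in> ?S" and "d v = Max (d ` ?S)" by auto
  then have top: "d w \<le> d v" if "w \<in> ?S" for w
    using that by auto
  define \<phi> :: "'a \<Rightarrow> int" where "\<phi> w = (if w = v then 1 else 0)" for w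
  \<comment> \<open>Only the parent arc of \<open>v\<close> sees the indicator function of \<open>v\<close>.\<close>
  have away: "Z f * (\<phi> (head G f) - \<phi> (tail G f)) = 0" if "f \<noteq> fst (p v)" for f
  proof (cases "Z f = 0")
    case False
    then obtain w where w: "w \<in> ?S" "f = fst (p w)"
      using assms(2) by (auto simp: support_def forest_arcs_def)
    have "w \<noteq> v" using w that by auto
    moreover have "dst (p w) \<noteq> v" using d[of w] top[OF w(1)] w(1) by force
    ultimately show ?thesis
      using p(2)[of w] w by (cases "p w"; cases "snd (p w)") (auto simp: \<phi>_def)
  qed simp
  have "dst (p v) \<noteq> v" using d[of v] v by force
  then have "Z (fst (p v)) * (\<phi> (head G (fst (p v))) - \<phi> (tail G (fst (p v)))) \<noteq> 0"
    using p(2)[of v] v by (cases "p v"; cases "snd (p v)") (auto simp: \<phi>_def)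
  moreover have "(\<Sum>f\<in>arcs G. Z f * (\<phi> (head G f) - \<phi> (tail G f)))
      = Z (fst (p v)) * (\<phi> (head G (fst (p v))) - \<phi> (tail G (fst (p v))))"
    using p(1)[of v] v away
    by (subst sum.remove[of _ "fst (p v)"]) (auto intro!: sum.neutral simp del: mult_eq_0_iff)
  ultimately show False using boundary[of \<phi>] by simp
qed

lemma forest_circuit_unique:
  assumes "rooted_forest R p" "X \<in> graphic_circuits G" "Y \<in> graphic_circuits G"
    and "support X \<subseteq> forest_arcs R p \<union> {e}" "support Y \<subseteq> forest_arcs R p \<union> {e}" "X e = Y e"
  shows "X = Y"
proof -
  let ?Z = "\<lambda>f. X f - Y f"
  have "support ?Z \<subseteq> forest_arcs R p"
    using assms(4-6) by (force simp: support_def)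
  moreover have "(\<Sum>f\<in>arcs G. ?Z f * (\<phi> (head G f) - \<phi> (tail G f))) = 0" for \<phi> :: "'a \<Rightarrow> int"
    using circuit_boundary[OF assms(2), of \<phi>] circuit_boundary[OF assms(3), of \<phi>]
    by (simp add: left_diff_distrib sum_subtractf)
  ultimately have "support ?Z = {}"
    by (rule forest_no_cycle_vector[OF assms(1)])
  then show ?thesis by (auto simp: support_def)
qed

lemma forest_indep:
  assumes "rooted_forest R p"
  shows "om_indep (arcs G) (graphic_circuits G) (forest_arcs R p)"
proof -
  have "\<not> support X \<subseteq> forest_arcs R p" if "X \<in> graphic_circuits G" for X
    using forest_no_cycle_vector[OF assms, of X] circuit_boundary[OF that] circuit_support_nonempty[OF that]
    by blast
  then show ?thesis
    using forest_arcs_subset[OF assms] by (simp add: om_indep_def)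
qed

section \<open>Forests with one root in each component are the bases\<close>

text \<open>
  Components are those of the whole digraph, so the same roots serve for all spanning forests.
\<close>

definition one_root_per_component :: "'a set \<Rightarrow> bool" where
  "one_root_per_component R \<longleftrightarrow>
     (\<forall>v\<in>verts G. \<exists>\<rho>\<in>R. (v, \<rho>) \<in> (steps (arcs G \<times> UNIV))\<^sup>*) \<and>
     (\<forall>\<rho>\<in>R. \<forall>\<sigma>\<in>R. (\<rho>, \<sigma>) \<in> (steps (arcs G \<times> UNIV))\<^sup>* \<longrightarrow> \<rho> = \<sigma>)"

lemma roots_exist:
  assumes "t \<in> verts G"
  obtains R where "one_root_per_component R" "t \<in> R"
proof -
  let ?c = "(steps (arcs G \<times> UNIV))\<^sup>*"
  \<comment> \<open>Hilbert choice returns the same vertex on a whole component, as it only sees the component.\<close>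
  define root where "root v = (if (v, t) \<in> ?c then t else (SOME w. (v, w) \<in> ?c))" for v
  have conn: "(v, root v) \<in> ?c" for v
    unfolding root_def using someI[of "\<lambda>w. (v, w) \<in> ?c" v] by auto
  have same: "root u = root v" if "(u, v) \<in> ?c" for u v
  proof -
    have "(u, w) \<in> ?c \<longleftrightarrow> (v, w) \<in> ?c" for w
      using that symD[OF sym_steps that] by (meson rtrancl_trans)
    then show ?thesis by (simp add: root_def)
  qed
  have "root \<rho> = \<rho>" if "\<rho> \<in> root ` verts G" for \<rho>
    using that same[OF conn] by auto
  then have "one_root_per_component (root ` verts G)"
    unfolding one_root_per_component_def using conn same by (metis imageI)
  moreover have "root t = t" by (simp add: root_def)
  then have "t \<in> root ` verts G" using assms by (metis imageI)
  ultimately show thesis by (rule that)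
qed

lemma climb_to_root:
  assumes "rooted_forest R p" "v \<in> verts G"
  shows "\<exists>\<rho>\<in>R. (v, \<rho>) \<in> (steps (p ` (verts G - R)))\<^sup>*"
proof -
  obtain d :: "'a \<Rightarrow> nat" where d: "\<forall>v\<in>verts G - R. d (dst (p v)) < d v"
    using assms by (auto simp: rooted_forest_def)
  show ?thesis using assms(2)
  proof (induction "d v" arbitrary: v rule: less_induct)
    case less
    show ?case
    proof (cases "v \<in> R")
      case False
      then have p: "fst (p v) \<in> arcs G" "src (p v) = v" "d (dst (p v)) < d v"
        using assms(1) d less.prems by (auto simp: rooted_forest_def)
      obtain \<rho> where "\<rho> \<in> R" "(dst (p v), \<rho>) \<in> (steps (p ` (verts G - R)))\<^sup>*"
        using less.hyps[OF p(3) src_dst_in_verts(2)[OF p(1)]] by blast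
      moreover have "(v, dst (p v)) \<in> steps (p ` (verts G - R))"
        using stepsI[of "p v" "p ` (verts G - R)"] p(2) False less.prems by auto
      ultimately show ?thesis by (meson converse_rtrancl_into_rtrancl)
    qed auto
  qed
qed

lemma forest_steps_subset: "p ` (verts G - R) \<subseteq> forest_arcs R p \<times> UNIV"
proof
  fix a assume "a \<in> p ` (verts G - R)"
  then have "fst a \<in> forest_arcs R p" by (auto simp: forest_arcs_def)
  then show "a \<in> forest_arcs R p \<times> UNIV" by (simp add: mem_Times_iff)
qed

text \<open>
  The parent assignment spans: climbing ends in a root, and there is only one it can reach.
\<close>

lemma climb_to_own_root:
  assumes "one_root_per_component R" "rooted_forest R p" "v \<in> verts G" "\<rho> \<in> R"
    and "(v, \<rho>) \<in> (steps (arcs G \<times> UNIV))\<^sup>*"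
  shows "(v, \<rho>) \<in> (steps (p ` (verts G - R)))\<^sup>*"
proof -
  obtain \<sigma> where \<sigma>: "\<sigma> \<in> R" "(v, \<sigma>) \<in> (steps (p ` (verts G - R)))\<^sup>*"
    using climb_to_root[OF assms(2,3)] by blast
  have "p ` (verts G - R) \<subseteq> arcs G \<times> UNIV"
    using forest_steps_subset[of p R] forest_arcs_subset[OF assms(2)] by fast
  then have "(v, \<sigma>) \<in> (steps (arcs G \<times> UNIV))\<^sup>*"
    using \<sigma>(2) by (rule steps_rtrancl_mono)
  then have "(\<rho>, \<sigma>) \<in> (steps (arcs G \<times> UNIV))\<^sup>*"
    using symD[OF sym_steps assms(5)] by (rule rtrancl_trans[rotated])
  then show ?thesis
    using assms(1,4) \<sigma> by (auto simp: one_root_per_component_def)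
qed

text \<open>
  Maximality: both ends of a further arc climb to the root of their component, so that the arc closes
  a cycle with the forest.
\<close>

lemma forest_basis:
  assumes "one_root_per_component R" "rooted_forest R p"
  shows "om_basis (arcs G) (graphic_circuits G) (forest_arcs R p)"
proof -
  let ?F = "forest_arcs R p"
  have max: "I = ?F" if I: "om_indep (arcs G) (graphic_circuits G) I" "?F \<subseteq> I" for I
  proof (rule ccontr)
    assume "I \<noteq> ?F"
    then obtain f where f: "f \<in> I" "f \<notin> ?F" "f \<in> arcs G"
      using I by (auto simp: om_indep_def)
    have fT: "?F \<times> UNIV \<subseteq> (arcs G - {f}) \<times> UNIV"
      using f forest_arcs_subset[OF assms(2)] by auto
    obtain \<rho> where \<rho>: "\<rho> \<in> R" "(tail G f, \<rho>) \<in> (steps (arcs G \<times> UNIV))\<^sup>*"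
      using assms(1) tail_in_verts[OF f(3)] unfolding one_root_per_component_def by blast
    have "(head G f, tail G f) \<in> steps (arcs G \<times> UNIV)"
      using stepsI[of "(f, False)"] f by force
    then have "(head G f, \<rho>) \<in> (steps (arcs G \<times> UNIV))\<^sup>*"
      using \<rho>(2) by (rule converse_rtrancl_into_rtrancl)
    then have "(head G f, \<rho>) \<in> (steps (?F \<times> UNIV))\<^sup>*" "(tail G f, \<rho>) \<in> (steps (?F \<times> UNIV))\<^sup>*"
      using climb_to_own_root[OF assms _ \<rho>(1)] \<rho>(2) f(3)
        steps_rtrancl_mono[OF forest_steps_subset] by auto
    then have "(head G f, tail G f) \<in> (steps (?F \<times> UNIV))\<^sup>*"
      using symD[OF sym_steps] by (meson rtrancl_trans)
    then obtain P where "set P \<subseteq> ?F \<times> UNIV" "cycle_traversal G ((f, True) # P)"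
      using path_closes_cycle[OF f(3) _ fT] by metis
    moreover from this have "support (traversal_signs ((f, True) # P)) \<subseteq> I"
      using I(2) f(1) by (auto simp: support_traversal_signs)
    ultimately show False
      using I(1) by (auto simp: om_indep_def graphic_circuits_def)
  qed
  then show ?thesis
    using forest_indep[OF assms(2)] by (auto simp: om_basis_def)
qed

text \<open>
  An arc \<open>f\<close> outside a basis \<open>B\<close> lies on a circuit within \<open>B \<union> {f}\<close>, whose other arcs bypass \<open>f\<close>.
\<close>

lemma basis_spans:
  assumes B: "om_basis (arcs G) (graphic_circuits G) B"
    and "(u, v) \<in> (steps (arcs G \<times> UNIV))\<^sup>*"
  shows "(u, v) \<in> (steps (B \<times> UNIV))\<^sup>*"
  using assms(2)
proof induction
  case (step v w)
  obtain f b where f: "f \<in> arcs G" "src (f, b) = v" "dst (f, b) = w"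
    using step.hyps(2) by (auto elim: stepsE)
  have "(tail G f, head G f) \<in> (steps (B \<times> UNIV))\<^sup>*"
  proof (cases "f \<in> B")
    case True
    then show ?thesis using stepsI[of "(f, True)" "B \<times> UNIV"] by auto
  next
    case False
    then have "\<not> om_indep (arcs G) (graphic_circuits G) (insert f B)"
      using B by (auto simp: om_basis_def)
    then obtain X where X: "X \<in> graphic_circuits G" "support X \<subseteq> insert f B"
      using B f(1) by (auto simp: om_basis_def om_indep_def)
    then have fX: "f \<in> support X"
      using B by (auto simp: om_basis_def om_indep_def)
    have "(support X - {f}) \<times> UNIV \<subseteq> B \<times> UNIV" using X(2) by auto
    then show ?thesis
      using circuit_connects_ends[OF X(1) fX] by (rule steps_rtrancl_mono)
  qed
  then have "(v, w) \<in> (steps (B \<times> UNIV))\<^sup>*"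
    using f symD[OF sym_steps] by (cases b) auto
  then show ?case using step.IH by (rule rtrancl_trans[rotated])
qed simp

text \<open>
  As a basis spans, every vertex has a finite distance to the roots within it, and the first arc of a
  shortest path serves as parent arc. The forest obtained lies in \<open>B\<close>; it is all of \<open>B\<close> because it
  is itself maximal independent.
\<close>

lemma basis_as_forest:
  assumes R: "one_root_per_component R" and B: "om_basis (arcs G) (graphic_circuits G) B"
  obtains p where "rooted_forest R p" "forest_arcs R p = B"
proof -
  let ?s = "steps (B \<times> UNIV)"
  define d where "d v = (LEAST n. \<exists>\<rho>\<in>R. (v, \<rho>) \<in> ?s ^^ n)" for v
  have Bsub: "B \<subseteq> arcs G" using B by (auto simp: om_basis_def om_indep_def)
  have "\<exists>a. fst a \<in> B \<and> src a = v \<and> d (dst a) < d v" if v: "v \<in> verts G - R" for v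
  proof -
    have "\<exists>\<rho>\<in>R. (v, \<rho>) \<in> ?s\<^sup>*"
      using R v basis_spans[OF B] unfolding one_root_per_component_def by blast
    then have "\<exists>n. \<exists>\<rho>\<in>R. (v, \<rho>) \<in> ?s ^^ n"
      by (auto simp: rtrancl_power)
    then have "\<exists>\<rho>\<in>R. (v, \<rho>) \<in> ?s ^^ d v"
      unfolding d_def by (rule LeastI_ex)
    then obtain \<rho> where \<rho>: "\<rho> \<in> R" "(v, \<rho>) \<in> ?s ^^ d v" by blast
    obtain m where m: "d v = Suc m"
      using \<rho> v by (cases "d v") auto
    then obtain w where w: "(v, w) \<in> ?s" "(w, \<rho>) \<in> ?s ^^ m"
      using \<rho>(2) by (metis relpow_Suc_D2)
    have "d w \<le> m" unfolding d_def using w(2) \<rho>(1) by (intro Least_le) auto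
    moreover obtain a where "a \<in> B \<times> UNIV" "src a = v" "dst a = w"
      using w(1) by (rule stepsE)
    ultimately have "fst a \<in> B \<and> src a = v \<and> d (dst a) < d v"
      using m by (simp add: mem_Times_iff)
    then show ?thesis ..
  qed
  then obtain p where p: "\<And>v. v \<in> verts G - R \<Longrightarrow> fst (p v) \<in> B \<and> src (p v) = v \<and> d (dst (p v)) < d v"
    by metis
  then have forest: "rooted_forest R p"
    using Bsub by (auto simp: rooted_forest_def)
  have "forest_arcs R p \<subseteq> B"
    using p by (auto simp: forest_arcs_def)
  then have "forest_arcs R p = B"
    using forest_basis[OF R forest] B by (auto simp: om_basis_def)
  then show thesis using that forest by blast
qed

section \<open>Embracing bases\<close>

text \<open>
  The steps from a vertex to its parent along an arc that points to the parent.
\<close>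

definition forward_steps :: "'a set \<Rightarrow> ('a \<Rightarrow> 'b \<times> bool) \<Rightarrow> 'a rel" where
  "forward_steps R p = steps {a \<in> p ` (verts G - R). snd a}"

text \<open>
  The path from the head of \<open>e\<close> up to the root \<open>tail G e\<close>, closed by \<open>e\<close>, is a circuit, and by
  uniqueness it is the fundamental circuit. Its signs are the directions in which the parent arcs
  are climbed.
\<close>

lemma embracing_iff_forward_path:
  assumes R: "one_root_per_component R" "tail G e \<in> R"
    and p: "rooted_forest R p" and e: "e \<in> arcs G" "e \<notin> forest_arcs R p"
  shows "embracing_basis (arcs G) (graphic_circuits G) e (forest_arcs R p)
    \<longleftrightarrow> (head G e, tail G e) \<in> (forward_steps R p)\<^sup>*"
proof -
  let ?F = "forest_arcs R p" and ?C = "graphic_circuits G"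
  have sub: "p ` (verts G - R) \<subseteq> (arcs G - {e}) \<times> UNIV"
    using forest_steps_subset[of p R] forest_arcs_subset[OF p] e(2) by fast
  have fund: "fund_circuit ?C ?F e = traversal_signs ((e, True) # P)"
    and mem: "traversal_signs ((e, True) # P) \<in> ?C"
    if P: "set P \<subseteq> p ` (verts G - R)" "cycle_traversal G ((e, True) # P)" for P
  proof -
    let ?X = "traversal_signs ((e, True) # P)"
    show X: "?X \<in> ?C" using P(2) by (auto simp: graphic_circuits_def)
    have supp: "support ?X \<subseteq> ?F \<union> {e}"
      using P(1) forest_steps_subset[of p R] by (fastforce simp: support_traversal_signs)
    have Xe: "?X e = 1" by (simp add: traversal_signs_def)
    show "fund_circuit ?C ?F e = ?X"
      unfolding fund_circuit_def
      using X supp Xe by (auto intro!: the_equality forest_circuit_unique[OF p, of _ _ e])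
  qed
  show ?thesis
  proof
    assume emb: "embracing_basis (arcs G) ?C e ?F"
    have "(head G e, tail G e) \<in> steps (arcs G \<times> UNIV)"
      using stepsI[of "(e, False)"] e by force
    then have "(head G e, tail G e) \<in> (steps (p ` (verts G - R)))\<^sup>*"
      using climb_to_own_root[OF R(1) p _ R(2)] head_in_verts[OF e(1)] by blast
    then obtain P where P: "set P \<subseteq> p ` (verts G - R)" "W.awalk (head G e) P (tail G e)"
        "cycle_traversal G ((e, True) # P)"
      using path_closes_cycle[OF e(1) _ sub] by metis
    have pos: "\<forall>f\<in>arcs G. traversal_signs ((e, True) # P) f \<in> {0, 1}"
      using emb fund[OF P(1,3)] by (auto simp: embracing_basis_def positive_circuits_at_def)
    have "snd a" if "a \<in> set P" for a
    proof -
      have "a \<in> (arcs G - {e}) \<times> UNIV" using that P(1) sub by blast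
      then have "fst a \<in> arcs G" by (simp add: mem_Times_iff)
      then have "traversal_signs ((e, True) # P) (fst a) \<in> {0, 1}" using pos by blast
      moreover have "traversal_signs ((e, True) # P) (fst a) = (if snd a then 1 else -1)"
        using that P(3) by (intro traversal_signs_arc) (auto simp: cycle_traversal_def)
      ultimately show ?thesis by (simp split: if_splits)
    qed
    then have "set P \<subseteq> {a \<in> p ` (verts G - R). snd a}" using P(1) by auto
    then show "(head G e, tail G e) \<in> (forward_steps R p)\<^sup>*"
      unfolding forward_steps_def using walk_imp_steps[OF P(2)] by (rule steps_rtrancl_mono)
  next
    assume path: "(head G e, tail G e) \<in> (forward_steps R p)\<^sup>*"
    have "{a \<in> p ` (verts G - R). snd a} \<subseteq> (arcs G - {e}) \<times> UNIV" using sub by auto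
    then obtain P where P: "set P \<subseteq> {a \<in> p ` (verts G - R). snd a}"
        "cycle_traversal G ((e, True) # P)"
      using path_closes_cycle[OF e(1) path[unfolded forward_steps_def]] by metis
    have sub': "set P \<subseteq> p ` (verts G - R)" using P(1) by blast
    have "traversal_signs ((e, True) # P) \<in> positive_circuits_at (arcs G) ?C e"
    proof -
      have "traversal_signs ((e, True) # P) \<in> ?C" by (rule mem[OF sub' P(2)])
      moreover have "(f, False) \<notin> set P" for f using subsetD[OF P(1), of "(f, False)"] by auto
      ultimately show ?thesis by (simp add: positive_circuits_at_def traversal_signs_def)
    qed
    then show "embracing_basis (arcs G) ?C e ?F"
      using forest_basis[OF R(1) p] e(2) fund[OF sub' P(2)] by (simp add: embracing_basis_def)
  qed
qed

section \<open>Switching parents one vertex at a time\<close>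

definition switched :: "'a set \<Rightarrow> ('a \<Rightarrow> 'b \<times> bool) \<Rightarrow> ('a \<Rightarrow> 'b \<times> bool) \<Rightarrow> 'a \<Rightarrow> 'b \<times> bool" where
  "switched S p p' v = (if v \<in> S then p' v else p v)"

text \<open>
  The sets of vertices that can have been switched so far. Roots have no parent arc and are never
  switched.
\<close>

definition closed_under_parents :: "'a set \<Rightarrow> ('a \<Rightarrow> 'b \<times> bool) \<Rightarrow> 'a set \<Rightarrow> bool" where
  "closed_under_parents R p S \<longleftrightarrow> S \<subseteq> verts G - R \<and> (\<forall>v\<in>S. dst (p v) \<in> S \<union> R)"

text \<open>
  Switched vertices climb through switched vertices to a root as \<open>p'\<close> prescribes; the others climb
  as \<open>p\<close> prescribes until they reach a root or a switched vertex.
\<close>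

lemma switched_forest:
  assumes p: "rooted_forest R p" and p': "rooted_forest R p'" and S: "closed_under_parents R p' S"
  shows "rooted_forest R (switched S p p')"
proof -
  obtain d :: "'a \<Rightarrow> nat" where d: "\<And>v. v \<in> verts G - R \<Longrightarrow> d (dst (p v)) < d v"
    using p by (auto simp: rooted_forest_def)
  obtain d' :: "'a \<Rightarrow> nat" where d': "\<And>v. v \<in> verts G - R \<Longrightarrow> d' (dst (p' v)) < d' v"
    using p' by (auto simp: rooted_forest_def)
  \<comment> \<open>Lifting the heights of the vertices not yet switched above all heights for \<open>p'\<close> combines both.\<close>
  define M where "M = Suc (Max (d' ` verts G))"
  have M: "d' v < M" if "v \<in> verts G" for v
    using that by (auto simp: M_def less_Suc_eq_le)
  define D where "D v = (if v \<in> S \<union> R then d' v else M + d v)" for v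
  have "D (dst (switched S p p' v)) < D v" if v: "v \<in> verts G - R" for v
  proof (cases "v \<in> S")
    case True
    then show ?thesis using S d'[OF v] by (auto simp: closed_under_parents_def D_def switched_def)
  next
    case False
    have "dst (p v) \<in> verts G"
      using p v src_dst_in_verts(2)[of "p v"] by (auto simp: rooted_forest_def)
    then have "d' (dst (p v)) < M" by (rule M)
    then show ?thesis using False v d[OF v] by (auto simp: D_def switched_def)
  qed
  then show ?thesis
    using p p' unfolding rooted_forest_def by (intro conjI exI[of _ D]) (auto simp: switched_def)
qed

lemma switched_forest_arcs: "forest_arcs R (switched S p p') \<subseteq> forest_arcs R p \<union> forest_arcs R p'"
  by (auto simp: forest_arcs_def switched_def)

lemma forward_stepE:
  assumes "(u, w) \<in> forward_steps R p" "rooted_forest R p"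
  shows "u \<in> verts G - R" "w = dst (p u)" "snd (p u)"
  using assms by (auto simp: forward_steps_def rooted_forest_def elim!: stepsE)

lemma forward_stepI:
  assumes "rooted_forest R p" "v \<in> verts G - R" "snd (p v)"
  shows "(v, dst (p v)) \<in> forward_steps R p"
  using stepsI[of "p v" "{a \<in> p ` (verts G - R). snd a}"] assms
  by (auto simp: forward_steps_def rooted_forest_def)

text \<open>
  The invariant of the switching process. While \<open>s\<close> is unswitched, only vertices that climb to \<open>t\<close>
  along forward arcs of \<open>p\<close> may have been switched. If \<open>s\<close> is itself a root, which happens for
  \<open>s = t\<close>, the second condition is void.
\<close>

definition forward_first :: "'a set \<Rightarrow> ('a \<Rightarrow> 'b \<times> bool) \<Rightarrow> 'a \<Rightarrow> 'a \<Rightarrow> 'a set \<Rightarrow> bool" where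
  "forward_first R p s t S \<longleftrightarrow> closed_under_parents R p S \<and>
     (s \<in> S \<union> R \<or> S \<subseteq> {v. (v, t) \<in> (forward_steps R p)\<^sup>*})"

text \<open>
  Among the vertices that the second condition of the invariant admits, a lowest one has its parent
  switched already: the parent of an admitted vertex is admitted as well, unless it is switched or
  a root. While \<open>s\<close> is unswitched, \<open>s\<close> itself is admitted, so the process cannot get stuck.
\<close>

lemma next_vertex_to_switch:
  assumes p: "rooted_forest R p" and st: "s \<in> verts G" "t \<in> R"
    and path: "(s, t) \<in> (forward_steps R p)\<^sup>*"
    and S: "forward_first R p s t S" "S \<noteq> verts G - R"
  obtains v where "v \<in> verts G - R - S" "forward_first R p s t (insert v S)"
proof -
  obtain d :: "'a \<Rightarrow> nat" where d: "\<And>v. v \<in> verts G - R \<Longrightarrow> d (dst (p v)) < d v"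
    using p by (auto simp: rooted_forest_def)
  have Ssub: "S \<subseteq> verts G - R" using S by (auto simp: forward_first_def closed_under_parents_def)
  let ?T = "{v \<in> verts G - R - S. s \<in> S \<union> R \<or> (v, t) \<in> (forward_steps R p)\<^sup>*}"
  have "?T \<noteq> {}" using Ssub S(2) st path by blast
  then obtain v where v: "v \<in> ?T" and least: "\<And>w. w \<in> ?T \<Longrightarrow> d v \<le> d w"
    using ex_has_least_nat[of "\<lambda>v. v \<in> ?T" _ d] by blast
  have V: "v \<in> verts G - R" using v by auto
  have "dst (p v) \<in> S \<union> R"
  proof (rule ccontr)
    assume out: "dst (p v) \<notin> S \<union> R"
    have "dst (p v) \<in> verts G"
      using p V src_dst_in_verts(2)[of "p v"] by (auto simp: rooted_forest_def)
    moreover have "(dst (p v), t) \<in> (forward_steps R p)\<^sup>*" if "s \<notin> S \<union> R"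
    proof -
      have "(v, t) \<in> (forward_steps R p)\<^sup>*" "v \<noteq> t" using v that V st(2) by auto
      then show ?thesis
        using forward_stepE(2)[OF _ p] by (metis converse_rtranclE)
    qed
    ultimately have "dst (p v) \<in> ?T" using out by auto
    then show False using least d[OF V] by (meson not_le)
  qed
  then have "forward_first R p s t (insert v S)"
    using S(1) v by (auto simp: forward_first_def closed_under_parents_def)
  then show thesis using that v by blast
qed

text \<open>
  The path of the mixed forest follows forward arcs of \<open>p\<close> up to the first switched vertex, if any,
  and forward arcs of \<open>p'\<close> from there on.
\<close>

lemma switched_forward_path:
  assumes p: "rooted_forest R p" and p': "rooted_forest R p'"
    and st: "s \<in> verts G" "t \<in> R"
    and path: "(s, t) \<in> (forward_steps R p)\<^sup>*" and path': "(s, t) \<in> (forward_steps R p')\<^sup>*"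
    and S: "forward_first R p' s t S"
  shows "(s, t) \<in> (forward_steps R (switched S p p'))\<^sup>*"
proof -
  let ?q = "switched S p p'"
  have closed: "closed_under_parents R p' S" using S by (auto simp: forward_first_def)
  have q: "rooted_forest R ?q" by (rule switched_forest[OF p p' closed])
  have inside: "(v, t) \<in> (forward_steps R ?q)\<^sup>*"
    if "(v, t) \<in> (forward_steps R p')\<^sup>*" "v \<in> S \<union> R" for v
    using that
  proof (induction rule: converse_rtrancl_induct)
    case (step v w)
    note v = forward_stepE[OF step.hyps(1) p']
    then have vS: "v \<in> S" using step.prems by auto
    then have "w \<in> S \<union> R" using closed v by (auto simp: closed_under_parents_def)
    moreover have "(v, w) \<in> forward_steps R ?q"
      using forward_stepI[OF q, of v] v vS by (auto simp: switched_def)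
    ultimately show ?case using step.IH by (meson converse_rtrancl_into_rtrancl)
  qed simp
  show ?thesis
  proof (cases "s \<in> S \<union> R")
    case True
    then show ?thesis using inside path' by blast
  next
    case False
    then have SF: "S \<subseteq> {v. (v, t) \<in> (forward_steps R p')\<^sup>*}"
      using S by (auto simp: forward_first_def)
    from path show ?thesis
    proof (induction rule: converse_rtrancl_induct)
      case (step v w)
      note v = forward_stepE[OF step.hyps(1) p]
      show ?case
      proof (cases "v \<in> S")
        case True
        then show ?thesis using inside SF by blast
      next
        case out: False
        then have "(v, w) \<in> forward_steps R ?q"
          using forward_stepI[OF q, of v] v by (auto simp: switched_def)
        then show ?thesis using step.IH by (meson converse_rtrancl_into_rtrancl)
      qed
    qed simp
  qed
qed

text \<open>
  By injectivity of the parent arcs, neither the old nor the new parent arc of \<open>v\<close> occurs elsewhere in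
  the forest, so a change of the arc set exchanges exactly one arc.
\<close>

lemma switch_one:
  assumes q: "rooted_forest R q" and q': "rooted_forest R q'" and v: "v \<in> verts G - R"
    and agree: "\<And>w. w \<noteq> v \<Longrightarrow> q' w = q w"
    and ne: "forest_arcs R q' \<noteq> forest_arcs R q"
  shows "card ((forest_arcs R q - forest_arcs R q') \<union> (forest_arcs R q' - forest_arcs R q)) = 2"
proof -
  let ?A = "(\<lambda>w. fst (q w)) ` (verts G - R - {v})"
  have remove: "f ` (verts G - R) = insert (f v) (f ` (verts G - R - {v}))" for f :: "'a \<Rightarrow> 'b"
    using v by blast
  have "(\<lambda>w. fst (q' w)) ` (verts G - R - {v}) = ?A"
    using agree by (intro image_cong) auto
  then have A: "forest_arcs R q = insert (fst (q v)) ?A" "forest_arcs R q' = insert (fst (q' v)) ?A"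
    unfolding forest_arcs_def by (simp_all only: remove)
  have out: "fst (q v) \<notin> ?A"
    using forest_parent_inj[OF q] v by (auto dest: inj_onD)
  have out': "fst (q' v) \<notin> ?A"
  proof
    assume "fst (q' v) \<in> ?A"
    then obtain w where w: "w \<in> verts G - R" "w \<noteq> v" "fst (q' v) = fst (q' w)"
      using agree by auto
    then show False using inj_onD[OF forest_parent_inj[OF q']] v by metis
  qed
  have "fst (q v) \<noteq> fst (q' v)" using ne A by auto
  moreover from this have "(forest_arcs R q - forest_arcs R q') \<union> (forest_arcs R q' - forest_arcs R q)
      = {fst (q v), fst (q' v)}"
    unfolding A using out out' by auto
  ultimately show ?thesis by simp
qed

lemma embracing_path_extend:
  assumes "embracing_path E C e B A k \<sigma>" "embracing_basis E C e A'"
    and "card ((A - A') \<union> (A' - A)) = 2"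
  shows "embracing_path E C e B A' (Suc k) (\<sigma>(Suc k := A'))"
  using assms by (auto simp: embracing_path_def le_Suc_eq)

text \<open>
  Vertices with the same parent arc in both forests cost no step of the path; therefore its length is
  bounded by the number of switched vertices rather than equal to it.
\<close>

lemma embracing_path_by_switching:
  assumes R: "one_root_per_component R" "tail G e \<in> R" and e: "e \<in> arcs G"
    and p: "rooted_forest R p" and p': "rooted_forest R p'"
    and emb: "embracing_basis (arcs G) (graphic_circuits G) e (forest_arcs R p)"
    and emb': "embracing_basis (arcs G) (graphic_circuits G) e (forest_arcs R p')"
  shows "\<exists>k \<le> card (verts G - R). \<exists>\<sigma>.
    embracing_path (arcs G) (graphic_circuits G) e (forest_arcs R p) (forest_arcs R p') k \<sigma>"
proof -
  let ?E = "arcs G" and ?C = "graphic_circuits G" and ?s = "head G e" and ?t = "tail G e"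
  let ?F = "\<lambda>S. forest_arcs R (switched S p p')"
  have e_out: "e \<notin> forest_arcs R p" "e \<notin> forest_arcs R p'"
    using emb emb' by (auto simp: embracing_basis_def)
  have path: "(?s, ?t) \<in> (forward_steps R p)\<^sup>*" and path': "(?s, ?t) \<in> (forward_steps R p')\<^sup>*"
    using emb emb' embracing_iff_forward_path[OF R _ e] p p' e_out by blast+
  have s: "?s \<in> verts G" using e by simp
  have forest: "rooted_forest R (switched S p p')" if "forward_first R p' ?s ?t S" for S
    using switched_forest[OF p p'] that by (auto simp: forward_first_def)
  have emb_S: "embracing_basis ?E ?C e (?F S)" if S: "forward_first R p' ?s ?t S" for S
  proof -
    have "e \<notin> ?F S" using e_out switched_forest_arcs[of R S p p'] by blast
    then show ?thesis
      using embracing_iff_forward_path[OF R forest[OF S] e]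
        switched_forward_path[OF p p' s R(2) path path' S] by blast
  qed
  have grow: "\<exists>S. forward_first R p' ?s ?t S \<and> card S = n \<and>
      (\<exists>k\<le>n. \<exists>\<sigma>. embracing_path ?E ?C e (forest_arcs R p) (?F S) k \<sigma>)"
    if "n \<le> card (verts G - R)" for n
    using that
  proof (induction n)
    case 0
    have "switched {} p p' = p" by (auto simp: switched_def)
    moreover have "embracing_path ?E ?C e (forest_arcs R p) (forest_arcs R p) 0 (\<lambda>_. forest_arcs R p)"
      using emb by (auto simp: embracing_path_def)
    ultimately show ?case
      by (intro exI[of _ "{}"]) (auto simp: forward_first_def closed_under_parents_def)
  next
    case (Suc n)
    then obtain S k \<sigma> where S: "forward_first R p' ?s ?t S" "card S = n" "k \<le> n"
        and \<sigma>: "embracing_path ?E ?C e (forest_arcs R p) (?F S) k \<sigma>"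
      by auto
    have "S \<noteq> verts G - R" using S(2) Suc.prems by auto
    then obtain v where v: "v \<in> verts G - R - S" "forward_first R p' ?s ?t (insert v S)"
      using next_vertex_to_switch[OF p' s R(2) path' S(1)] by blast
    have "finite S"
      using S(1) finite_subset[of S "verts G"] by (auto simp: forward_first_def closed_under_parents_def)
    then have card: "card (insert v S) = Suc n" using S(2) v(1) by simp
    have "\<exists>k\<le>Suc n. \<exists>\<sigma>. embracing_path ?E ?C e (forest_arcs R p) (?F (insert v S)) k \<sigma>"
    proof (cases "?F (insert v S) = ?F S")
      case True
      then show ?thesis using \<sigma> S(3) by (metis le_SucI)
    next
      case False
      have "card ((?F S - ?F (insert v S)) \<union> (?F (insert v S) - ?F S)) = 2"
        by (rule switch_one[OF forest[OF S(1)] forest[OF v(2)] _ _ False, of v])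
          (use v(1) in \<open>auto simp: switched_def\<close>)
      then show ?thesis
        using embracing_path_extend[OF \<sigma> emb_S[OF v(2)]] S(3) by (meson Suc_le_mono)
    qed
    then show ?case using v(2) card by blast
  qed
  then obtain S k \<sigma> where S: "forward_first R p' ?s ?t S" "card S = card (verts G - R)"
      and k: "k \<le> card (verts G - R)"
      and \<sigma>: "embracing_path ?E ?C e (forest_arcs R p) (?F S) k \<sigma>"
    using grow[OF order_refl] by blast
  have "S = verts G - R"
    using S by (intro card_subset_eq) (auto simp: forward_first_def closed_under_parents_def)
  then have "?F S = forest_arcs R p'"
    by (auto simp: forest_arcs_def switched_def)
  then show ?thesis using \<sigma> k by auto
qed

lemma indep_card_le_rank:
  assumes "om_indep (arcs G) C I"
  shows "card I \<le> om_rank (arcs G) C"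
proof -
  have "{I. om_indep (arcs G) C I} \<subseteq> Pow (arcs G)" by (auto simp: om_indep_def)
  then have "finite {I. om_indep (arcs G) C I}" by (rule finite_subset) simp
  then show ?thesis unfolding om_rank_def using assms by (intro Max_ge) auto
qed

text \<open>
  A basis has one arc for each vertex outside \<open>R\<close>, so the number of switches is at most the rank.
\<close>

lemma embracing_distance_le_rank:
  assumes e: "e \<in> arcs G"
    and B: "embracing_basis (arcs G) (graphic_circuits G) e B"
    and B': "embracing_basis (arcs G) (graphic_circuits G) e B'"
  shows "embracing_distance (arcs G) (graphic_circuits G) e B B'
    \<le> enat (om_rank (arcs G) (graphic_circuits G))"
proof -
  obtain R where R: "one_root_per_component R" "tail G e \<in> R"
    using roots_exist[of "tail G e"] e by auto
  obtain p where p: "rooted_forest R p" "forest_arcs R p = B"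
    using basis_as_forest[OF R(1)] B by (auto simp: embracing_basis_def)
  obtain p' where p': "rooted_forest R p'" "forest_arcs R p' = B'"
    using basis_as_forest[OF R(1)] B' by (auto simp: embracing_basis_def)
  obtain k \<sigma> where k: "k \<le> card (verts G - R)"
      and path: "embracing_path (arcs G) (graphic_circuits G) e B B' k \<sigma>"
    using embracing_path_by_switching[OF R e p(1) p'(1)] p p' B B' by auto
  have "card (verts G - R) = card B"
    using card_image[OF forest_parent_inj[OF p(1)]] p(2) by (simp add: forest_arcs_def)
  also have "\<dots> \<le> om_rank (arcs G) (graphic_circuits G)"
    using indep_card_le_rank forest_indep[OF p(1)] p(2) by auto
  finally have "k \<le> om_rank (arcs G) (graphic_circuits G)" using k by simp
  moreover have "embracing_distance (arcs G) (graphic_circuits G) e B B' \<le> enat k"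
    unfolding embracing_distance_def using path by (intro Inf_lower) auto
  ultimately show ?thesis by (meson enat_ord_simps(1) order_trans)
qed

end

theorem theorem1p6:
  fixes D :: "('v, 'a) pre_digraph" and E :: "'a set" and C :: "'a signed_set set"
    and r :: nat and e :: 'a and B B' :: "'a set"
  assumes "graphic_oriented_matroid D E C"
    and "om_rank E C = r"
    and "e \<in> E"
    and "embracing_basis E C e B"
    and "embracing_basis E C e B'"
  shows "embracing_distance E C e B B' \<le> enat r"
  using fin_digraph.embracing_distance_le_rank[of D e B B'] assms
  by (auto simp: graphic_oriented_matroid_def)

end
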